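(* Let $G_1,G_2$ be finite simple connected graphs, $G_i$ having $n_i$ vertices and $m_i$ edges. Then the strong product $G_1\boxtimes G_2$ satisfies \begin{align*} F(G_1\boxtimes G_2)={}&n_2F(G_1)+n_1F(G_2)+F(G_1)F(G_2)+6m_2M_1(G_1)+6m_1M_1(G_2)+6m_2F(G_1)\\ &+6m_1F(G_2)+3F(G_2)M_1(G_1)+3F(G_1)M_1(G_2)+6M_1(G_1)M_1(G_2). \end{align*}
   Context: The strong product $G_1\boxtimes G_2$ has vertex set $V(G_1)\times V(G_2)$, with $(u_p,v_r)$ adjacent to $(u_q,v_s)$ iff [$u_p=u_q$ and $v_rv_s\in E(G_2)$] or [$v_r=v_s$ and $u_pu_q\in E(G_1)$] or [$u_pu_q\in E(G_1)$ and $v_rv_s\in E(G_2)$]. For a finite simple graph $G$ with vertex degrees $d_G(v)$: $M_1(G)=\sum_{v} d_G(v)^2$ and $F(G)=\sum_{v} d_G(v)^3$. *)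

theory Defs
  imports "Graph_Theory.Digraph_Component"
begin

text \<open>
  Finite simple graphs are the \<^locale>\<open>pair_graph\<close>s of the library: finite, loop-free,
  symmetric digraphs whose arcs are ordered pairs of vertices. An undirected edge \<open>uv\<close> is thus
  represented by the two arcs \<open>(u, v)\<close> and \<open>(v, u)\<close>; edges are counted as unordered pairs,
  and the degree of a vertex is its out-degree.
\<close>

definition edges :: "'a pair_pre_digraph \<Rightarrow> 'a set set" where
  "edges G = {{u, v} | u v. (u, v) \<in> parcs G}"

definition degree :: "'a pair_pre_digraph \<Rightarrow> 'a \<Rightarrow> nat" where
  "degree G v = out_degree (with_proj G) v"

definition first_zagreb :: "'a pair_pre_digraph \<Rightarrow> nat" where
  "first_zagreb G = (\<Sum>v \<in> pverts G. degree G v ^ 2)"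

definition F_index :: "'a pair_pre_digraph \<Rightarrow> nat" where
  "F_index G = (\<Sum>v \<in> pverts G. degree G v ^ 3)"

definition strong_product ::
    "'a pair_pre_digraph \<Rightarrow> 'b pair_pre_digraph \<Rightarrow> ('a \<times> 'b) pair_pre_digraph"
    (infixl \<open>\<boxtimes>\<close> 70) where
  "G \<boxtimes> H = \<lparr>
     pverts = pverts G \<times> pverts H,
     parcs = {((u, v), (u', v')) | u v u' v'.
       u \<in> pverts G \<and> u' \<in> pverts G \<and> v \<in> pverts H \<and> v' \<in> pverts H \<and>
       (u = u' \<and> (v, v') \<in> parcs H \<or>
        v = v' \<and> (u, u') \<in> parcs G \<or>
        (u, u') \<in> parcs G \<and> (v, v') \<in> parcs H)} \<rparr>"

lemma pair_graph_strong_product: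
  assumes "pair_graph G" and "pair_graph H"
  shows "pair_graph (G \<boxtimes> H)"
proof -
  interpret G: pair_graph G by fact
  interpret H: pair_graph H by fact
  have "parcs (G \<boxtimes> H) \<subseteq> (pverts G \<times> pverts H) \<times> (pverts G \<times> pverts H)"
    by (auto simp: strong_product_def)
  then have "finite (parcs (G \<boxtimes> H))"
    by (rule finite_subset) (simp add: G.pair_finite_verts H.pair_finite_verts)
  moreover have "sym (parcs (G \<boxtimes> H))"
    unfolding sym_def strong_product_def
    by (auto dest: G.arcs_symmetric H.arcs_symmetric)
  ultimately show ?thesis
    by unfold_locales
      (auto simp: strong_product_def symmetric_def G.pair_finite_verts H.pair_finite_verts
        dest: G.no_loops' H.no_loops')
qed

end

theory Submission
  imports Defs
begin

lemma degree_eq_card_neighbours: "degree G v = card {w. (v, w) \<in> parcs G}"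
proof -
  have "out_arcs (with_proj G) v = Pair v ` {w. (v, w) \<in> parcs G}"
    by (auto simp: out_arcs_def)
  then show ?thesis
    by (simp add: degree_def out_degree_def card_image inj_on_def)
qed

lemma (in pair_graph) sum_degree_eq: "(\<Sum>v\<in>pverts G. degree G v) = 2 * card (edges G)"
proof -
  let ?e = "\<lambda>(u, v). {u, v}"
  have finN: "finite {w. (v, w) \<in> parcs G}" for v
    by (rule finite_subset[of _ "snd ` parcs G"]) (force, simp)
  have parcs: "parcs G = (SIGMA v:pverts G. {w. (v, w) \<in> parcs G})"
    using in_arcsD1 by auto
  have edges: "edges G = ?e ` parcs G"
    by (force simp: edges_def)
  have fibre: "card {a \<in> parcs G. ?e a = e} = 2" if e: "e \<in> edges G" for e
  proof -
    obtain u v where uv: "e = {u, v}" "(u, v) \<in> parcs G"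
      using e unfolding edges_def by blast
    then have "(v, u) \<in> parcs G" "u \<noteq> v"
      using arcs_symmetric no_loops' by auto
    with uv have "{a \<in> parcs G. ?e a = e} = {(u, v), (v, u)}"
      by (auto simp: doubleton_eq_iff)
    with \<open>u \<noteq> v\<close> show ?thesis
      by simp
  qed
  have "(\<Sum>v\<in>pverts G. degree G v) = card (parcs G)"
    by (subst parcs) (simp add: degree_eq_card_neighbours finN)
  also have "\<dots> = (\<Sum>e\<in>edges G. card {a \<in> parcs G. ?e a = e})"
    using sum.image_gen[of "parcs G" "\<lambda>_. 1::nat" ?e] by (simp add: edges)
  also have "\<dots> = 2 * card (edges G)"
    by (simp add: fibre)
  finally show ?thesis .
qed

text \<open>A closed neighbourhood in the strong product is the product of the closed neighbourhoods.\<close>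

lemma Suc_degree_strong_product:
  assumes "pair_graph G" "pair_graph H" "u \<in> pverts G" "v \<in> pverts H"
  shows "Suc (degree (G \<boxtimes> H) (u, v)) = Suc (degree G u) * Suc (degree H v)"
proof -
  interpret G: pair_graph G by fact
  interpret H: pair_graph H by fact
  have Suc_degree: "Suc (degree K x) = card (insert x {y. (x, y) \<in> parcs K})"
    if "pair_graph K" for K :: "'c pair_pre_digraph" and x
  proof -
    interpret K: pair_graph K by fact
    have "finite {y. (x, y) \<in> parcs K}"
      by (rule finite_subset[of _ "snd ` parcs K"]) (force, simp)
    moreover have "x \<notin> {y. (x, y) \<in> parcs K}"
      using K.no_loops' by auto
    ultimately show ?thesis
      by (simp add: degree_eq_card_neighbours)
  qed
  have "insert (u, v) {y. ((u, v), y) \<in> parcs (G \<boxtimes> H)} =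
      insert u {x. (u, x) \<in> parcs G} \<times> insert v {y. (v, y) \<in> parcs H}"
    using assms(3,4) G.in_arcsD2 H.in_arcsD2 by (auto simp: strong_product_def)
  then show ?thesis
    using assms(1,2) pair_graph_strong_product[OF assms(1,2)]
    by (simp only: Suc_degree card_cartesian_product)
qed

theorem theorem7:
  fixes G1 :: "'a pair_pre_digraph" and G2 :: "'b pair_pre_digraph"
    and n1 n2 m1 m2 :: nat
  assumes "pair_graph G1" and "Digraph_Component.connected (with_proj G1)"
    and "pair_graph G2" and "Digraph_Component.connected (with_proj G2)"
    and "n1 = card (pverts G1)" and "m1 = card (edges G1)"
    and "n2 = card (pverts G2)" and "m2 = card (edges G2)"
  shows "F_index (G1 \<boxtimes> G2) =
      n2 * F_index G1 + n1 * F_index G2 + F_index G1 * F_index G2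
    + 6 * m2 * first_zagreb G1 + 6 * m1 * first_zagreb G2 + 6 * m2 * F_index G1
    + 6 * m1 * F_index G2 + 3 * F_index G2 * first_zagreb G1
    + 3 * F_index G1 * first_zagreb G2 + 6 * first_zagreb G1 * first_zagreb G2"
proof -
  let ?a = "degree G1" and ?b = "degree G2"
  have deg: "degree (G1 \<boxtimes> G2) (u, v) = ?a u + ?b v + ?a u * ?b v"
    if "u \<in> pverts G1" "v \<in> pverts G2" for u v
    using Suc_degree_strong_product[OF assms(1,3) that] by simp
  have pverts: "pverts (G1 \<boxtimes> G2) = pverts G1 \<times> pverts G2"
    by (simp add: strong_product_def)
  have cube: "(a + b + a * b) ^ 3 =
      a ^ 3 + b ^ 3 + a ^ 3 * b ^ 3 + 3 * (a ^ 2 * b) + 3 * (a * b ^ 2) + 3 * (a ^ 3 * b)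
      + 3 * (a * b ^ 3) + 3 * (a ^ 2 * b ^ 3) + 3 * (a ^ 3 * b ^ 2) + 6 * (a ^ 2 * b ^ 2)"
    for a b :: nat
    by algebra
  have "F_index (G1 \<boxtimes> G2) =
      (\<Sum>u\<in>pverts G1. \<Sum>v\<in>pverts G2. (?a u + ?b v + ?a u * ?b v) ^ 3)"
    unfolding F_index_def sum.cartesian_product
    by (rule sum.cong) (auto simp: deg pverts)
  also have "\<dots> = n2 * F_index G1 + n1 * F_index G2 + F_index G1 * F_index G2
      + 3 * (first_zagreb G1 * (2 * m2)) + 3 * (2 * m1 * first_zagreb G2)
      + 3 * (F_index G1 * (2 * m2)) + 3 * (2 * m1 * F_index G2)
      + 3 * (first_zagreb G1 * F_index G2) + 3 * (F_index G1 * first_zagreb G2)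
      + 6 * (first_zagreb G1 * first_zagreb G2)"
    unfolding cube F_index_def first_zagreb_def assms(5-8)
      pair_graph.sum_degree_eq[OF assms(1), symmetric]
      pair_graph.sum_degree_eq[OF assms(3), symmetric]
    by (simp add: sum.distrib flip: sum_distrib_left sum_distrib_right)
  finally show ?thesis
    by (simp add: algebra_simps)
qed

end
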